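(* There are at most $n-1$ pairwise orthogonal Italian squares (POIS) of order $n$.
   Context: An Italian square $L$ of order $n$ is an $n\times n$ array, with each cell containing a signed formal sum of a subset of symbols from $\{1,\dots,n\}$, such that each formal sum in ascending order, and each symbol in a row or column, alternates in sign beginning and ending with $+$. It corresponds to the $n\times n\times n$ array $(a_{ijk})$ with entries in $\{0,1,-1\}$, where $a_{ijk}$ is the coefficient of symbol $k$ in cell $(i,j)$; in this array the non-zero entries along each line (obtained by fixing two of the three indices) alternate in sign, beginning and ending with $+1$. The planes of $L$ are the matrices $L_k=(a_{ijk})_{i,j}$, $k=1,\dots,n$. Two Italian squares $A$ and $B$ of order $n$ with planes $A_1,\dots,A_n$ and $B_1,\dots,B_n$ are orthogonal if $\langle A_i,B_j\rangle=1$ for all $i,j\in\{1,\dots,n\}$, where $\langle M,N\rangle=\mathrm{tr}(MN^\top)$ is the Frobenius inner product. A set of pairwise orthogonal Italian squares (POIS) of order $n$ is a set of Italian squares of order $n$ in which each distinct pair is orthogonal.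
   Formalization: The order n is assumed to be at least 2; for n = 1 the single Italian square [1] forms a one-element (vacuously pairwise orthogonal) set, exceeding n-1 = 0, and for n = 0 the bound is -1. *)

theory Defs
  imports "Jordan_Normal_Form.Matrix" "HOL-Library.Poly_Mapping"
begin

definition alternates :: "int list \<Rightarrow> bool" where
  "alternates xs \<longleftrightarrow>
    (let ys = filter (\<lambda>x. x \<noteq> 0) xs in
      ys \<noteq> [] \<and> hd ys = 1 \<and> last ys = 1 \<and> successively (\<lambda>x y. y = - x) ys)"

text \<open>
  A cell holds a formal sum with integer coefficients of the symbols \<open>1, \<dots>, n\<close>, encoded as a
  finitely supported function. Symbols are numbered from 1, while rows and columns are numbered
  from 0, as is usual for the type \<^typ>\<open>'a mat\<close>.
\<close>

type_synonym square = "(nat \<Rightarrow>\<^sub>0 int) mat"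

definition italian_square :: "nat \<Rightarrow> square \<Rightarrow> bool" where
  "italian_square n L \<longleftrightarrow>
    L \<in> carrier_mat n n \<and>
    (\<forall>i<n. \<forall>j<n. Poly_Mapping.keys (L $$ (i, j)) \<subseteq> {1..n} \<and>
       (\<forall>k. Poly_Mapping.lookup (L $$ (i, j)) k \<in> {0, 1, - 1})) \<and>
    (\<forall>i<n. \<forall>j<n. alternates (map (\<lambda>k. Poly_Mapping.lookup (L $$ (i, j)) k) [1..<n + 1])) \<and>
    (\<forall>i<n. \<forall>k\<in>{1..n}. alternates (map (\<lambda>j. Poly_Mapping.lookup (L $$ (i, j)) k) [0..<n])) \<and>
    (\<forall>j<n. \<forall>k\<in>{1..n}. alternates (map (\<lambda>i. Poly_Mapping.lookup (L $$ (i, j)) k) [0..<n]))"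

definition plane :: "square \<Rightarrow> nat \<Rightarrow> int mat" where
  "plane L k = map_mat (\<lambda>s. Poly_Mapping.lookup s k) L"

definition trace_mat :: "int mat \<Rightarrow> int" where
  "trace_mat M = sum_list (diag_mat M)"

definition frobenius_inner :: "int mat \<Rightarrow> int mat \<Rightarrow> int" where
  "frobenius_inner M N = trace_mat (M * transpose_mat N)"

definition orthogonal_squares :: "nat \<Rightarrow> square \<Rightarrow> square \<Rightarrow> bool" where
  "orthogonal_squares n A B \<longleftrightarrow>
    (\<forall>i\<in>{1..n}. \<forall>j\<in>{1..n}. frobenius_inner (plane A i) (plane B j) = 1)"

definition POIS :: "nat \<Rightarrow> square set \<Rightarrow> bool" where
  "POIS n S \<longleftrightarrow> (\<forall>L\<in>S. italian_square n L) \<and> pairwise (orthogonal_squares n) S"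

end

theory Submission
  imports Defs
begin

text \<open>
  The bound is a dimension count. Every line of an alternating array sums to 1, so for a square
  \<open>A\<close> with planes \<open>A\<^sub>1, \<dots>, A\<^sub>n\<close> the combinations \<open>\<Sum>k. c\<^sub>k A\<^sub>k\<close> with \<open>\<Sum>k. c\<^sub>k = 0\<close> are matrices all
  of whose row and column sums vanish. The matrices with vanishing row and column sums form a space
  of dimension \<open>(n - 1)\<^sup>2\<close>, because they are determined by their leading \<open>(n - 1) \<times> (n - 1)\<close>
  submatrix (\<open>zero_line_sums_determined_by_submatrix\<close>).

  Two facts make the spaces \<open>U\<^sub>A\<close> of such combinations, one for each square of the family, fill
  \<open>n - 1\<close> dimensions each without overlap. If \<open>A\<close> and \<open>B\<close> are orthogonal, then
  \<open>\<langle>\<Sum>k. c\<^sub>k A\<^sub>k, \<Sum>l. d\<^sub>l B\<^sub>l\<rangle> = (\<Sum>k. c\<^sub>k) (\<Sum>l. d\<^sub>l) = 0\<close>, so the spaces are mutually orthogonal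
  and their sum is direct. And the planes of one square are linearly independent
  (\<open>planes_linearly_independent\<close>): the first entry of an alternating line is never \<open>-1\<close>, so
  the first row of an Italian square is an ordinary permutation of the symbols. Hence
  \<open>N\<close> squares require \<open>N (n - 1) \<le> (n - 1)\<^sup>2\<close>.

  The count is carried out with coefficients instead of spaces. Given \<open>n\<close> squares, the \<open>n\<^sup>2\<close> unknown
  coefficients \<open>c\<^sub>A\<^sub>k\<close> are subjected to the \<open>n\<close> conditions \<open>\<Sum>k. c\<^sub>A\<^sub>k = 0\<close> and to the \<open>(n - 1)\<^sup>2\<close>
  conditions that \<open>\<Sum>A, k. c\<^sub>A\<^sub>k A\<^sub>k\<close> vanishes on the leading submatrix. As
  \<open>n + (n - 1)\<^sup>2 < n\<^sup>2\<close> for \<open>n \<ge> 2\<close>, there is a nontrivial solution, which the two facts exclude.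
\<close>

section \<open>Homogeneous linear systems\<close>

text \<open>
  Gaussian elimination, one equation at a time: an equation with a nonzero coefficient is used to
  eliminate the corresponding unknown, which lowers both the number of equations and the number of
  unknowns by one.
\<close>

lemma homogeneous_system_nontrivial_solution:
  fixes a :: "'e \<Rightarrow> 'i \<Rightarrow> 'f::field"
  assumes "finite E" "finite I" "card E < card I"
  shows "\<exists>c. (\<exists>i\<in>I. c i \<noteq> 0) \<and> (\<forall>e\<in>E. (\<Sum>i\<in>I. c i * a e i) = 0)"
  using assms
proof (induction E arbitrary: I a rule: finite_induct)
  case empty
  then obtain i where "i \<in> I" by (metis card.empty ex_in_conv less_irrefl)
  then show ?case by (intro exI[of _ "\<lambda>_. 1"]) auto
next
  case (insert e E)
  show ?case
  proof (cases "\<forall>i\<in>I. a e i = 0")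
    case True
    from insert obtain c where "\<exists>i\<in>I. c i \<noteq> 0" "\<forall>f\<in>E. (\<Sum>i\<in>I. c i * a f i) = 0"
      by (metis Suc_lessD card_insert_disjoint)
    with True show ?thesis by (intro exI[of _ c]) auto
  next
    case False
    then obtain p where p: "p \<in> I" "a e p \<noteq> 0" by blast
    \<comment> \<open>the coefficients that remain after equation \<open>e\<close> is solved for the unknown \<open>p\<close>\<close>
    define a' where "a' f i = a f i - a f p * a e i / a e p" for f i
    have "card E < card (I - {p})" using insert p by simp
    then obtain c where c: "\<exists>i\<in>I - {p}. c i \<noteq> 0"
        "\<And>f. f \<in> E \<Longrightarrow> (\<Sum>i\<in>I - {p}. c i * a' f i) = 0"
      using insert.IH[of "I - {p}" a'] insert.prems(1) by auto
    define s where "s = (\<Sum>i\<in>I - {p}. c i * a e i)"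
    define d where "d = c(p := - s / a e p)"
    have d: "(\<Sum>i\<in>I. d i * a f i) = (\<Sum>i\<in>I - {p}. c i * a f i) - s / a e p * a f p" for f
    proof -
      have "(\<Sum>i\<in>I - {p}. d i * a f i) = (\<Sum>i\<in>I - {p}. c i * a f i)"
        by (rule sum.cong) (auto simp: d_def)
      then show ?thesis
        using sum.remove[OF insert.prems(1) p(1), of "\<lambda>i. d i * a f i"] by (simp add: d_def)
    qed
    have "(\<Sum>i\<in>I. d i * a f i) = 0" if "f \<in> insert e E" for f
    proof (cases "f = e")
      case True
      then show ?thesis using p by (simp add: d flip: s_def)
    next
      case False
      have "(\<Sum>i\<in>I - {p}. c i * a' f i)
          = (\<Sum>i\<in>I - {p}. c i * a f i) - (\<Sum>i\<in>I - {p}. c i * a e i * (a f p / a e p))"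
        by (simp add: a'_def algebra_simps sum_subtractf)
      then have "(\<Sum>i\<in>I - {p}. c i * a' f i)
          = (\<Sum>i\<in>I - {p}. c i * a f i) - s * (a f p / a e p)"
        by (simp only: s_def sum_distrib_right)
      with c(2) False that show ?thesis by (simp add: d)
    qed
    moreover have "\<exists>i\<in>I. d i \<noteq> 0" using c(1) by (auto simp: d_def)
    ultimately show ?thesis by blast
  qed
qed

section \<open>Matrices with zero line sums\<close>

lemma zero_line_sums_determined_by_submatrix:
  fixes W :: "nat \<Rightarrow> nat \<Rightarrow> 'a::comm_monoid_add"
  assumes rows: "\<And>i. i \<le> m \<Longrightarrow> (\<Sum>j\<le>m. W i j) = 0"
    and cols: "\<And>j. j \<le> m \<Longrightarrow> (\<Sum>i\<le>m. W i j) = 0"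
    and sub: "\<And>i j. i < m \<Longrightarrow> j < m \<Longrightarrow> W i j = 0"
    and "i \<le> m" "j \<le> m"
  shows "W i j = 0"
proof -
  have last_column: "W i m = 0" if "i < m" for i
    using rows[of i] sub that by (simp add: lessThan_Suc_atMost[symmetric])
  have "W m j = 0" if "j \<le> m" for j
    using cols[of j] sub last_column that
    by (cases "j = m") (simp_all add: lessThan_Suc_atMost[symmetric])
  with assms(4,5) sub last_column show ?thesis
    by (metis le_neq_implies_less)
qed

section \<open>Alternating lines\<close>

text \<open>
  All terms but the last cancel in pairs, as the list begins and ends with the same sign.
\<close>

lemma sum_alternating_signs:
  fixes ys :: "int list"
  assumes "ys \<noteq> []" "hd ys = 1" "last ys = 1" "successively (\<lambda>x y. y = - x) ys"
  shows "sum_list ys = 1"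
  using assms
proof (induction ys rule: induct_list012)
  case (3 x y zs)
  then show ?case by (cases zs) auto
qed auto

lemma sum_list_alternates:
  assumes "alternates xs"
  shows "sum_list xs = 1"
proof -
  have "sum_list (filter (\<lambda>x. x \<noteq> 0) xs) = 1"
    using assms by (intro sum_alternating_signs) (auto simp: alternates_def Let_def)
  moreover have "sum_list (filter (\<lambda>x. x \<noteq> 0) xs) = sum_list xs"
    by (induction xs) auto
  ultimately show ?thesis by simp
qed

text \<open>
  A nonzero first entry is the first sign of the alternation. This boundary effect is what turns the
  first row of an Italian square into a permutation.
\<close>

lemma alternates_Cons_nonneg: "alternates (x # xs) \<Longrightarrow> x \<ge> 0"
  by (cases "x = 0") (auto simp: alternates_def Let_def)

section \<open>Italian squares as three-dimensional arrays\<close>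

definition entry :: "square \<Rightarrow> nat \<Rightarrow> nat \<Rightarrow> nat \<Rightarrow> int" where
  "entry L i j k = Poly_Mapping.lookup (L $$ (i, j)) k"

lemma italian_square_line_sums:
  assumes "italian_square n L"
  shows sum_symbols: "\<lbrakk>i < n; j < n\<rbrakk> \<Longrightarrow> (\<Sum>k\<in>{1..n}. entry L i j k) = 1"
    and sum_columns: "\<lbrakk>i < n; k \<in> {1..n}\<rbrakk> \<Longrightarrow> (\<Sum>j<n. entry L i j k) = 1"
    and sum_rows: "\<lbrakk>j < n; k \<in> {1..n}\<rbrakk> \<Longrightarrow> (\<Sum>i<n. entry L i j k) = 1"
proof -
  have *: "(\<Sum>x\<in>{a..<b}. f x) = 1" if "alternates (map f [a..<b])" for f a b
    using sum_list_alternates[OF that] by (simp add: interv_sum_list_conv_sum_set_nat)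
  show "\<lbrakk>i < n; j < n\<rbrakk> \<Longrightarrow> (\<Sum>k\<in>{1..n}. entry L i j k) = 1"
    using *[of "entry L i j" 1 "n + 1"] assms
    by (simp add: italian_square_def entry_def[abs_def] atLeastLessThanSuc_atLeastAtMost)
  show "\<lbrakk>i < n; k \<in> {1..n}\<rbrakk> \<Longrightarrow> (\<Sum>j<n. entry L i j k) = 1"
    using *[of "\<lambda>j. entry L i j k" 0 n] assms
    by (simp add: italian_square_def entry_def[abs_def] atLeast0LessThan)
  show "\<lbrakk>j < n; k \<in> {1..n}\<rbrakk> \<Longrightarrow> (\<Sum>i<n. entry L i j k) = 1"
    using *[of "\<lambda>i. entry L i j k" 0 n] assms
    by (simp add: italian_square_def entry_def[abs_def] atLeast0LessThan)
qed

lemma first_row_nonneg: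
  assumes "italian_square n L" "j < n" "k \<in> {1..n}"
  shows "entry L 0 j k \<ge> 0"
proof (rule alternates_Cons_nonneg)
  have "[0..<n] = 0 # [1..<n]" using assms(2) by (simp add: upt_rec)
  with assms show "alternates (entry L 0 j k # map (\<lambda>i. entry L i j k) [1..<n])"
    by (auto simp: italian_square_def entry_def dest!: spec[of _ j])
qed

text \<open>
  The entries of the first row are nonnegative integers, and those of a single cell sum to 1. So a
  cell in which symbol \<open>k\<close> occurs contains \<open>k\<close> once and nothing else; such a cell exists because
  the entries of \<open>k\<close> in the first row sum to 1.
\<close>

lemma first_row_cell_of_symbol:
  assumes L: "italian_square n L" and k: "k \<in> {1..n}"
  obtains j where "j < n" "\<And>k'. k' \<in> {1..n} \<Longrightarrow> entry L 0 j k' = (if k' = k then 1 else 0)"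
proof -
  have n: "0 < n" using k by auto
  have "\<exists>j<n. entry L 0 j k \<noteq> 0"
    using sum_columns[OF L n k] by (metis lessThan_iff sum.neutral zero_neq_one)
  then obtain j where j: "j < n" "entry L 0 j k \<ge> 1"
    using first_row_nonneg[OF L _ k] by force
  have nonneg: "entry L 0 j k' \<ge> 0" if "k' \<in> {1..n}" for k'
    using first_row_nonneg[OF L j(1) that] .
  have "entry L 0 j k + (\<Sum>k'\<in>{1..n} - {k}. entry L 0 j k') = 1"
    using sum_symbols[OF L n j(1)] sum.remove[OF _ k, of "entry L 0 j"] by simp
  moreover have ge: "(\<Sum>k'\<in>{1..n} - {k}. entry L 0 j k') \<ge> 0"
    using nonneg by (intro sum_nonneg) auto
  ultimately have "entry L 0 j k = 1" and sum0: "(\<Sum>k'\<in>{1..n} - {k}. entry L 0 j k') = 0"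
    using j(2) by linarith+
  moreover have "\<forall>k'\<in>{1..n} - {k}. entry L 0 j k' = 0"
    using sum0 nonneg by (subst (asm) sum_nonneg_eq_0_iff) auto
  ultimately show thesis using j(1) by (intro that[of j]) auto
qed

text \<open>
  The first row alone suffices: in the cell that contains just the symbol \<open>k\<close>, the combination has
  the value \<open>c k\<close>.
\<close>

lemma planes_linearly_independent:
  fixes c :: "nat \<Rightarrow> real"
  assumes L: "italian_square n L"
    and zero: "\<And>j. j < n \<Longrightarrow> (\<Sum>k\<in>{1..n}. c k * entry L 0 j k) = 0"
    and k: "k \<in> {1..n}"
  shows "c k = 0"
proof -
  obtain j where j: "j < n"
      "\<And>k'. k' \<in> {1..n} \<Longrightarrow> entry L 0 j k' = (if k' = k then 1 else 0)"
    using first_row_cell_of_symbol[OF L k] by blast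
  have "(\<Sum>k'\<in>{1..n}. c k' * entry L 0 j k') = (\<Sum>k'\<in>{1..n}. if k' = k then c k' else 0)"
    by (rule sum.cong) (auto simp: j(2))
  also have "\<dots> = c k" using k by simp
  finally show ?thesis using zero[OF j(1)] by simp
qed

lemma frobenius_inner_planes:
  assumes "A \<in> carrier_mat n n" "B \<in> carrier_mat n n"
  shows "frobenius_inner (plane A k) (plane B l) = (\<Sum>i<n. \<Sum>j<n. entry A i j k * entry B i j l)"
  using assms
  by (auto simp: frobenius_inner_def trace_mat_def diag_mat_def plane_def entry_def
      scalar_prod_def interv_sum_list_conv_sum_set_nat atLeast0LessThan intro!: sum.cong)

section \<open>The dimension count\<close>

text \<open>
  Excluding exactly \<open>n\<close> squares is enough, since every larger or infinite family
  contains such a subfamily.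
\<close>

lemma no_n_pairwise_orthogonal_squares:
  assumes n: "n \<ge> 2" and fin: "finite T" and card: "card T = n" and pois: "POIS n T"
  shows False
proof -
  have ital: "italian_square n A" if "A \<in> T" for A
    using pois that by (simp add: POIS_def)
  have orth: "(\<Sum>i<n. \<Sum>j<n. entry A i j k * entry B i j l) = 1"
    if "A \<in> T" "B \<in> T" "A \<noteq> B" "k \<in> {1..n}" "l \<in> {1..n}" for A B k l
  proof -
    have "orthogonal_squares n A B" using pois that by (auto simp: POIS_def pairwise_def)
    then have "frobenius_inner (plane A k) (plane B l) = 1"
      using that(4,5) by (simp add: orthogonal_squares_def)
    moreover have "A \<in> carrier_mat n n" "B \<in> carrier_mat n n"
      using ital that by (auto simp: italian_square_def)
    ultimately show ?thesis using frobenius_inner_planes by simp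
  qed
  define m where "m = n - 1"
  have nm: "n = Suc m" "m \<ge> 1" using n by (auto simp: m_def)
  have lessn: "{..<n} = {..m}" using nm by auto

  \<comment> \<open>The unknowns are indexed by a square and a symbol. Equation \<open>Inl B\<close> says that the coefficients
      of \<open>B\<close> sum to 0; equation \<open>Inr (i, j)\<close> says that the combination of all planes
      vanishes in cell \<open>(i, j)\<close> of the leading submatrix.\<close>
  define I where "I = T \<times> {1..n}"
  define E :: "(square + nat \<times> nat) set" where "E = T <+> {..<m} \<times> {..<m}"
  define a :: "square + nat \<times> nat \<Rightarrow> square \<times> nat \<Rightarrow> real" where
    "a e x = (case (e, x) of
       (Inl B, (A, k)) \<Rightarrow> (if A = B then 1 else 0)
     | (Inr (i, j), (A, k)) \<Rightarrow> real_of_int (entry A i j k))" for e x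
  have "card E = n + m * m" using fin card by (simp add: E_def card_Plus)
  moreover have "card I = n * n" using card by (simp add: I_def card_cartesian_product)
  ultimately have "card E < card I" using nm by simp
  moreover have "finite E" "finite I" using fin by (auto simp: E_def I_def)
  ultimately obtain d where d: "\<exists>x\<in>I. d x \<noteq> 0" "\<And>e. e \<in> E \<Longrightarrow> (\<Sum>x\<in>I. d x * a e x) = 0"
    using homogeneous_system_nontrivial_solution[of E I a] by blast
  define c where "c A k = d (A, k)" for A k
  have sys: "(\<Sum>A\<in>T. \<Sum>k\<in>{1..n}. c A k * a e (A, k)) = 0" if "e \<in> E" for e
    using d(2)[OF that] by (simp add: I_def c_def sum.cartesian_product)
  have csum: "(\<Sum>k\<in>{1..n}. c B k) = 0" if B: "B \<in> T" for B
  proof -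
    have "Inl B \<in> E" using B by (auto simp: E_def)
    from sys[OF this] have "(\<Sum>A\<in>T. \<Sum>k\<in>{1..n}. c A k * (if A = B then 1 else 0)) = 0"
      by (simp add: a_def)
    also have "(\<Sum>A\<in>T. \<Sum>k\<in>{1..n}. c A k * (if A = B then 1 else 0))
        = (\<Sum>A\<in>T. if A = B then (\<Sum>k\<in>{1..n}. c A k) else 0)"
      by (rule sum.cong) auto
    also have "\<dots> = (\<Sum>k\<in>{1..n}. c B k)" using B fin by simp
    finally show ?thesis .
  qed

  \<comment> \<open>\<open>W A\<close> is the part of the combination that comes from the square \<open>A\<close>, and \<open>V\<close> is the whole.\<close>
  define W where "W A i j = (\<Sum>k\<in>{1..n}. c A k * entry A i j k)" for A i j
  define V where "V i j = (\<Sum>A\<in>T. W A i j)" for i j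
  have Wrow: "(\<Sum>j<n. W A i j) = 0" if A: "A \<in> T" and i: "i < n" for A i
  proof -
    have "(\<Sum>j<n. W A i j) = (\<Sum>k\<in>{1..n}. c A k * of_int (\<Sum>j<n. entry A i j k))"
      unfolding W_def by (subst sum.swap) (simp add: sum_distrib_left)
    also have "\<dots> = (\<Sum>k\<in>{1..n}. c A k)"
      by (rule sum.cong) (simp_all only: sum_columns[OF ital[OF A] i] of_int_1 mult_1_right)
    finally show ?thesis using csum[OF A] by simp
  qed
  have Wcol: "(\<Sum>i<n. W A i j) = 0" if A: "A \<in> T" and j: "j < n" for A j
  proof -
    have "(\<Sum>i<n. W A i j) = (\<Sum>k\<in>{1..n}. c A k * of_int (\<Sum>i<n. entry A i j k))"
      unfolding W_def by (subst sum.swap) (simp add: sum_distrib_left)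
    also have "\<dots> = (\<Sum>k\<in>{1..n}. c A k)"
      by (rule sum.cong) (simp_all only: sum_rows[OF ital[OF A] j] of_int_1 mult_1_right)
    finally show ?thesis using csum[OF A] by simp
  qed
  have V0: "V i j = 0" if "i < n" "j < n" for i j
  proof (rule zero_line_sums_determined_by_submatrix[of m V])
    show "(\<Sum>j\<le>m. V i j) = 0" if "i \<le> m" for i
      unfolding V_def lessn[symmetric] by (subst sum.swap) (use that nm Wrow in simp)
    show "(\<Sum>i\<le>m. V i j) = 0" if "j \<le> m" for j
      unfolding V_def lessn[symmetric] by (subst sum.swap) (use that nm Wcol in simp)
    show "V i j = 0" if "i < m" "j < m" for i j
      using sys[of "Inr (i, j)"] that by (simp add: E_def InrI a_def V_def W_def)
  qed (use that nm in auto)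

  have Worth: "(\<Sum>i<n. \<Sum>j<n. W A i j * W B i j) = 0" if "A \<in> T" "B \<in> T" "A \<noteq> B" for A B
  proof -
    have "(\<Sum>i<n. \<Sum>j<n. W A i j * W B i j)
        = (\<Sum>i<n. \<Sum>j<n. \<Sum>k\<in>{1..n}. \<Sum>l\<in>{1..n}.
             (c A k * c B l) * of_int (entry A i j k * entry B i j l))"
      unfolding W_def sum_product by (simp add: algebra_simps)
    also have "\<dots> = (\<Sum>k\<in>{1..n}. \<Sum>l\<in>{1..n}. \<Sum>i<n. \<Sum>j<n.
             (c A k * c B l) * of_int (entry A i j k * entry B i j l))"
      by (simp only: sum.swap[of _ "{1..n}" "{..<n}"])
    also have "\<dots> = (\<Sum>k\<in>{1..n}. \<Sum>l\<in>{1..n}.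
             (c A k * c B l) * of_int (\<Sum>i<n. \<Sum>j<n. entry A i j k * entry B i j l))"
      by (simp only: sum_distrib_left of_int_sum)
    also have "\<dots> = (\<Sum>k\<in>{1..n}. \<Sum>l\<in>{1..n}. c A k * c B l)"
      by (intro sum.cong refl) (simp only: orth[OF that] of_int_1 mult_1_right)
    also have "\<dots> = (\<Sum>k\<in>{1..n}. c A k) * (\<Sum>l\<in>{1..n}. c B l)"
      by (simp only: sum_product)
    finally show ?thesis using csum that by simp
  qed
  \<comment> \<open>Pairing \<open>W A\<close> with \<open>V = 0\<close> leaves only the squared norm of \<open>W A\<close>.\<close>
  have W0: "W A i j = 0" if A: "A \<in> T" and ij: "i < n" "j < n" for A i j
  proof -
    have "0 = (\<Sum>i<n. \<Sum>j<n. W A i j * V i j)" by (simp add: V0)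
    also have "\<dots> = (\<Sum>B\<in>T. \<Sum>i<n. \<Sum>j<n. W A i j * W B i j)"
      unfolding V_def sum_distrib_left by (simp only: sum.swap[of _ T "{..<n}"])
    also have "\<dots> = (\<Sum>B\<in>T. if B = A then \<Sum>i<n. \<Sum>j<n. W A i j * W A i j else 0)"
      using Worth[OF A] by (intro sum.cong) auto
    also have "\<dots> = (\<Sum>i<n. \<Sum>j<n. W A i j * W A i j)" using A fin by simp
    finally have "(\<Sum>(i, j)\<in>{..<n} \<times> {..<n}. W A i j * W A i j) = 0"
      by (simp add: sum.cartesian_product)
    then have "\<forall>p\<in>{..<n} \<times> {..<n}. (case p of (i, j) \<Rightarrow> W A i j * W A i j) = 0"
      by (subst (asm) sum_nonneg_eq_0_iff) auto
    then show ?thesis using ij by auto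
  qed
  have "c A k = 0" if "A \<in> T" "k \<in> {1..n}" for A k
    using planes_linearly_independent[OF ital[OF that(1)] _ that(2), of "c A"]
      W0[OF that(1), of 0] n by (simp add: W_def)
  then show False using d(1) by (auto simp: I_def c_def)
qed

theorem theorem6p4:
  fixes n :: nat and S :: "square set"
  assumes "n \<ge> 2" and "POIS n S"
  shows "finite S \<and> card S \<le> n - 1"
proof (rule ccontr)
  assume *: "\<not> (finite S \<and> card S \<le> n - 1)"
  obtain T where T: "T \<subseteq> S" "finite T" "card T = n"
  proof (cases "finite S")
    case True
    with * have "n \<le> card S" by auto
    then show thesis using that by (metis obtain_subset_with_card_n)
  next
    case False
    then show thesis using that infinite_arbitrarily_large by metis
  qed
  then have "POIS n T" using assms(2) by (auto simp: POIS_def pairwise_def)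
  then show False using no_n_pairwise_orthogonal_squares assms(1) T by blast
qed

end
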